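(* Let ${\boldsymbol b}=(b_1,\dots,b_s)\ne{\boldsymbol 0}$ be an integer vector with $b_1\ge\cdots\ge b_s\ge0$. Then the function $f(p,s,m,n',{\boldsymbol b})$ is strictly decreasing in $n'$ (with $p,s,m,{\boldsymbol b}$ fixed) and strictly increasing in $m$ (with $p,s,n',{\boldsymbol b}$ fixed).
   Context: $p$ is a prime, $s,m$ are positive integers, $n'\ge0$ is an integer, and ${\boldsymbol b}$ satisfies $m=b_0\ge b_1\ge\cdots\ge b_s\ge0$ (so $m\ge b_1$). $[p,0]=1$ and $[p,\ell]=\prod_{j=1}^{\ell}(1-p^{-j})$ for $\ell\ge1$. With $b_0=m$, $$f(p,s,m,n',{\boldsymbol b})=p^{-\sum_{i=1}^{s}(n'+b_i)b_i}\cdot\frac{[p,n'+m][p,m]}{[p,n'+b_s][p,b_s]\prod_{i=1}^{s}[p,b_{i-1}-b_i]}.$$ *)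

theory Defs
  imports Complex_Main "HOL-Computational_Algebra.Primes"
begin

definition pbracket :: "nat \<Rightarrow> nat \<Rightarrow> real" where
  "pbracket p l = (\<Prod>j=1..l. 1 - 1 / real p ^ j)"

(* The vector (b_1, ..., b_s) is encoded as a function b :: nat => nat of which only the values
   at 1, ..., s are used. The update b(0 := m) implements the convention b_0 = m, so b 0 itself
   is irrelevant. The truncated subtraction on nat agrees with the usual one
   when m >= b_1 >= ... >= b_s. *)
definition f :: "nat \<Rightarrow> nat \<Rightarrow> nat \<Rightarrow> nat \<Rightarrow> (nat \<Rightarrow> nat) \<Rightarrow> real" where
  "f p s m n' b =
     1 / real p ^ (\<Sum>i=1..s. (n' + b i) * b i) *
     ((pbracket p (n' + m) * pbracket p m) /
      (pbracket p (n' + b s) * pbracket p (b s) *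
        (\<Prod>i=1..s. pbracket p ((b(0 := m)) (i - 1) - b i))))"

end

theory Submission
  imports Defs
begin

text \<open>
  Both monotonicity claims are about a single step, because almost every factor of \<open>f\<close> cancels
  in the quotient of two consecutive values. Put \<open>q = 1/p\<close>, so that \<open>0 < q \<le> 1/2\<close>. Then

  \<open>f (n'+1) / f n' = q^(b 1 + \<dots> + b s) * (1 - q^(n'+1+m)) / (1 - q^(n'+1+b s))\<close>,

  \<open>f (m+1) / f m = (1 - q^(n'+m+1)) * (1 - q^(m+1)) / (1 - q^(m+1-b 1))\<close>.

  As \<open>b\<close> is nonzero and weakly decreasing, \<open>b 1 \<ge> 1\<close>. In the first quotient the numerator is
  below \<open>q \<le> 1/2\<close> while the denominator is at least \<open>1 - q \<ge> 1/2\<close>. In the second,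
  \<open>q^(m+1-b 1) \<ge> q^m \<ge> 2 * q^(m+1)\<close> outweighs the loss \<open>q^(n'+m+1) + q^(m+1)\<close>
  of the two factors in the numerator, and their product term makes the inequality strict.
\<close>

lemma pbracket_Suc: "pbracket p (Suc l) = pbracket p l * (1 - (1 / real p) ^ Suc l)"
  by (simp add: pbracket_def power_one_over)

lemma pbracket_pos:
  assumes "p \<ge> 2"
  shows "pbracket p l > 0"
  unfolding pbracket_def
proof (rule prod_pos)
  fix j assume "j \<in> {1..l}"
  then have "real p ^ j > 1"
    using assms by (intro one_less_power) auto
  then show "1 - 1 / real p ^ j > 0"
    by (simp add: divide_less_eq)
qed

text \<open>The variable \<open>m\<close> enters the product in the denominator of \<open>f\<close> through its first factor only.\<close>

lemma f_split_first:
  assumes "s \<ge> 1"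
  shows "f p s m n' b =
    (1 / real p) ^ (\<Sum>i=1..s. (n' + b i) * b i) *
    ((pbracket p (n' + m) * pbracket p m) /
     (pbracket p (n' + b s) * pbracket p (b s) *
       (pbracket p (m - b 1) * (\<Prod>i=2..s. pbracket p (b (i - 1) - b i)))))"
proof -
  have "(\<Prod>i=1..s. pbracket p ((b(0 := m)) (i - 1) - b i)) =
      pbracket p (m - b 1) * (\<Prod>i=2..s. pbracket p ((b(0 := m)) (i - 1) - b i))"
    using assms by (simp add: prod.atLeast_Suc_atMost numeral_2_eq_2)
  also have "(\<Prod>i=2..s. pbracket p ((b(0 := m)) (i - 1) - b i)) =
      (\<Prod>i=2..s. pbracket p (b (i - 1) - b i))"
    by (rule prod.cong) auto
  finally show ?thesis
    by (simp add: f_def power_one_over)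
qed

lemma f_pos:
  assumes "p \<ge> 2"
  shows "f p s m n' b > 0"
  using assms unfolding f_def
  by (intro mult_pos_pos divide_pos_pos prod_pos zero_less_power) (auto intro: pbracket_pos)

text \<open>
  The next two lemmas are the quotients \<open>f (n'+1) / f n'\<close> and \<open>f (m+1) / f m\<close>, stated without
  division. They hold because raising \<open>l\<close> by one multiplies \<open>pbracket p l\<close> by the single factor
  \<open>1 - q^(l+1)\<close>.
\<close>

lemma f_Suc_n:
  assumes "p \<ge> 2"
  shows "f p s m (Suc n') b * (1 - (1 / real p) ^ Suc (n' + b s)) =
    f p s m n' b * ((1 / real p) ^ (\<Sum>i=1..s. b i) * (1 - (1 / real p) ^ Suc (n' + m)))"
proof -
  have exponent: "(\<Sum>i=1..s. Suc (n' + b i) * b i) = (\<Sum>i=1..s. (n' + b i) * b i) + (\<Sum>i=1..s. b i)"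
    by (simp add: sum.distrib[symmetric] add.commute)
  have power_less: "(1 / real p) ^ Suc (n' + b s) < 1"
    using assms by (intro power_Suc_less_one) auto
  have cancel: "(e * t) * (N * x * M / (D * y * C * R)) * y = e * (N * M / (D * C * R)) * (t * x)"
    if "y \<noteq> 0" for e t N x M D y C R :: real
    using that by (simp add: mult_ac)
  show ?thesis
    unfolding f_def add_Suc exponent pbracket_Suc power_one_over[symmetric]
    unfolding power_add
    by (rule cancel) (use power_less in linarith)
qed

lemma f_Suc_m:
  assumes "p \<ge> 2" and "s \<ge> 1" and "b 1 \<le> m"
  shows "f p s (Suc m) n' b * (1 - (1 / real p) ^ Suc (m - b 1)) =
    f p s m n' b * ((1 - (1 / real p) ^ Suc (n' + m)) * (1 - (1 / real p) ^ Suc m))"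
proof -
  have power_less: "(1 / real p) ^ Suc (m - b 1) < 1"
    using assms by (intro power_Suc_less_one) auto
  have cancel: "e * (N * x * (M * z) / (C * (D * y * R))) * y = e * (N * M / (C * (D * R))) * (x * z)"
    if "y \<noteq> 0" for e N x M z C D y R :: real
    using that by simp
  show ?thesis
    unfolding f_split_first[OF assms(2)] Suc_diff_le[OF assms(3)] add_Suc_right pbracket_Suc
    by (rule cancel) (use power_less in linarith)
qed

lemma f_step_n:
  assumes "p \<ge> 2" and "(\<Sum>i=1..s. b i) \<ge> 1"
  shows "f p s m (Suc n') b < f p s m n' b"
proof -
  define q where "q = 1 / real p"
  have q: "0 < q" "q \<le> 1 / 2"
    using assms by (auto simp: q_def field_simps)
  have q_power: "q ^ k \<le> q" if "k \<ge> 1" for k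
    using power_decreasing[of 1 k q] q that by simp
  define c where "c = q ^ (\<Sum>i=1..s. b i) * (1 - q ^ Suc (n' + m))"
  define d where "d = 1 - q ^ Suc (n' + b s)"
  have "c < q ^ (\<Sum>i=1..s. b i)"
    using q by (simp add: c_def)
  also have "\<dots> \<le> q"
    using q_power assms(2) by blast
  also have "\<dots> \<le> d"
    using q q_power[of "Suc (n' + b s)"] by (simp add: d_def del: power_Suc)
  finally have "c < d" .
  have "d > 0"
    using q q_power[of "Suc (n' + b s)"] by (simp add: d_def del: power_Suc)
  have "f p s m (Suc n') b * d = f p s m n' b * c"
    using f_Suc_n[OF assms(1)] by (simp add: c_def d_def q_def)
  also have "\<dots> < f p s m n' b * d"
    using \<open>c < d\<close> f_pos[OF assms(1)] by simp
  finally show ?thesis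
    using \<open>d > 0\<close> by simp
qed

lemma f_step_m:
  assumes "p \<ge> 2" and "s \<ge> 1" and "b 1 \<ge> 1" and "b 1 \<le> m"
  shows "f p s m n' b < f p s (Suc m) n' b"
proof -
  define q where "q = 1 / real p"
  have q: "0 < q" "q \<le> 1 / 2"
    using assms by (auto simp: q_def field_simps)
  define c where "c = (1 - q ^ Suc (n' + m)) * (1 - q ^ Suc m)"
  define d where "d = 1 - q ^ Suc (m - b 1)"
  have "q ^ Suc (n' + m) + q ^ Suc m \<le> 2 * q ^ Suc m"
    using power_decreasing[of "Suc m" "Suc (n' + m)" q] q by simp
  also have "\<dots> \<le> q ^ m"
    using mult_right_mono[of "2 * q" 1 "q ^ m"] q by simp
  also have "\<dots> \<le> q ^ Suc (m - b 1)"
    using power_decreasing[of "Suc (m - b 1)" m q] q assms by simp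
  finally have "q ^ Suc (n' + m) + q ^ Suc m \<le> q ^ Suc (m - b 1)" .
  moreover have "q ^ Suc (n' + m) * q ^ Suc m > 0"
    using q by simp
  ultimately have "d < c"
    by (simp add: c_def d_def algebra_simps del: power_Suc)
  have "d > 0"
    using power_Suc_less_one[of q "m - b 1"] q by (simp add: d_def del: power_Suc)
  have "f p s m n' b * d < f p s m n' b * c"
    using \<open>d < c\<close> f_pos[OF assms(1)] by simp
  also have "\<dots> = f p s (Suc m) n' b * d"
    using f_Suc_m[of p s b m n'] assms by (simp add: c_def d_def q_def)
  finally show ?thesis
    using \<open>d > 0\<close> by simp
qed

theorem theorem5p6:
  fixes p s :: nat and b :: "nat \<Rightarrow> nat"
  assumes "prime p"
    and "s \<ge> 1"
    and "antimono_on {1..s} b"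
    and "\<exists>i\<in>{1..s}. b i \<noteq> 0"
  shows "(\<forall>m. m \<ge> 1 \<and> m \<ge> b 1 \<longrightarrow> strict_antimono_on UNIV (\<lambda>n'. f p s m n' b)) \<and>
         (\<forall>n'. strict_mono_on {m. m \<ge> 1 \<and> m \<ge> b 1} (\<lambda>m. f p s m n' b))"
proof -
  have p: "p \<ge> 2"
    using assms(1) by (rule prime_ge_2_nat)
  obtain i where i: "i \<in> {1..s}" "b i \<noteq> 0"
    using assms(4) by blast
  have "b i \<le> b 1"
    using monotone_onD[OF assms(3), of 1 i] i by simp
  then have b1: "b 1 \<ge> 1"
    using i by simp
  have "b 1 \<le> (\<Sum>i=1..s. b i)"
    using assms(2) by (intro member_le_sum) auto
  then have total: "(\<Sum>i=1..s. b i) \<ge> 1"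
    using b1 by linarith
  have decreasing: "strict_antimono_on UNIV (\<lambda>n'. f p s m n' b)" for m
  proof (rule monotone_onI)
    fix k l :: nat assume "k < l"
    then show "f p s m k b > f p s m l b"
      using lift_Suc_mono_less[of "\<lambda>n'. - f p s m n' b" k l] f_step_n[OF p total] by simp
  qed
  have increasing: "strict_mono_on {m. m \<ge> 1 \<and> m \<ge> b 1} (\<lambda>m. f p s m n' b)" for n'
  proof (rule monotone_onI)
    fix k l assume "k \<in> {m. m \<ge> 1 \<and> m \<ge> b 1}" "l \<in> {m. m \<ge> 1 \<and> m \<ge> b 1}" "k < l"
    then have kl: "b 1 \<le> k" "b 1 \<le> l" "k - b 1 < l - b 1"
      by (auto intro: diff_less_mono)
    \<comment> \<open>The step inequality fails below \<open>b 1\<close>, so it is iterated on the shifted sequence.\<close>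
    show "f p s k n' b < f p s l n' b"
      using kl lift_Suc_mono_less[of "\<lambda>j. f p s (b 1 + j) n' b" "k - b 1" "l - b 1"]
        f_step_m[where b = b, OF p assms(2) b1] by simp
  qed
  show ?thesis
    using decreasing increasing by blast
qed

end
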